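(* Consider the partitioned GARK scheme with coefficients $(\mathbf A^{\{\ell,m\}},\mathbf b^{\{m\}},\widehat{\mathbf A}^{\{\ell,m\}},\widehat{\mathbf b}^{\{m\}})_{\ell,m=1}^N$. It is symmetric if, for all $\ell,m=1,\dots,N$, $$\mathbf b^{\{m\}}=\underline{\mathbf b}^{\{m\}},\quad \widehat{\mathbf b}^{\{m\}}=\underline{\widehat{\mathbf b}}^{\{m\}},\quad \mathbf A^{\{\ell,m\}}=\underline{\mathbf A}^{\{\ell,m\}},\quad \widehat{\mathbf A}^{\{\ell,m\}}=\underline{\widehat{\mathbf A}}^{\{\ell,m\}}.$$ In other words, the partitioned GARK scheme is symmetric if and only if both the base scheme $(\mathbf A^{\{\ell,m\}},\mathbf b^{\{m\}})$ and the (discrete adjoint) scheme $(\widehat{\mathbf A}^{\{\ell,m\}},\widehat{\mathbf b}^{\{m\}})$ are symmetric.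
   Context: Partitioned GARK scheme. For Hamiltonians $H=\sum_{m=1}^N(T^{\{m\}}(\mathbf p)+V^{\{m\}}(\mathbf q))$, with $\mathbf A^{\{q,m\}}\in\mathbb R^{\hat s^{\{q\}}\times s^{\{m\}}}$, $\widehat{\mathbf A}^{\{q,m\}}\in\mathbb R^{s^{\{q\}}\times\hat s^{\{m\}}}$, $\mathbf b^{\{m\}}\in\mathbb R^{s^{\{m\}}}$, $\widehat{\mathbf b}^{\{m\}}\in\mathbb R^{\hat s^{\{m\}}}$: $$P_i^{\{q\}}=\mathbf p_0+h\sum_{m,j}\widehat a_{i,j}^{\{q,m\}}k_j^{\{m\}},\qquad Q_i^{\{q\}}=\mathbf q_0+h\sum_{m,j}a_{i,j}^{\{q,m\}}\ell_j^{\{m\}},$$ $$\mathbf p_1=\mathbf p_0+h\sum_{q,i}\widehat b_i^{\{q\}}k_i^{\{q\}},\qquad \mathbf q_1=\mathbf q_0+h\sum_{q,i}b_i^{\{q\}}\ell_i^{\{q\}},$$ $$k_i^{\{m\}}=-V^{\{m\}}_{\mathbf q}(Q_i^{\{m\}}),\qquad \ell_i^{\{m\}}=T^{\{m\}}_{\mathbf p}(P_i^{\{m\}}).$$ Assembling $\mathbf A=[\mathbf A^{\{q,m\}}]$, $\widehat{\mathbf A}=[\widehat{\mathbf A}^{\{q,m\}}]$, $\mathbf b=[\mathbf b^{\{m\}}]$, $\widehat{\mathbf b}=[\widehat{\mathbf b}^{\{m\}}]$, it is the GARK scheme with $2N$ partitions and tableau $$\mathbf A_{\mathrm{GARK}}=\begin{bmatrix}\mathbf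 0&\widehat{\mathbf A}\\ \mathbf A&\mathbf 0\end{bmatrix},\qquad \mathbf b_{\mathrm{GARK}}=\begin{bmatrix}\mathbf b\\ \widehat{\mathbf b}\end{bmatrix},$$ where the diagonal blocks have no effect on the computation and are always set to $\mathbf 0$. Time reversal. For a block with rows indexed by the stages of one partition and columns by the stages of another, underlining means: weights $\underline{\mathbf b}^{\{m\}}=\mathcal P\mathbf b^{\{m\}}$, $\underline{\widehat{\mathbf b}}^{\{m\}}=\mathcal P\widehat{\mathbf b}^{\{m\}}$, and $\underline{\mathbf A}^{\{\ell,m\}}=\mathbf 1\,\mathbf b^{\{m\}\top}-\mathcal P\mathbf A^{\{\ell,m\}}\mathcal P$, $\underline{\widehat{\mathbf A}}^{\{\ell,m\}}=\mathbf 1\,\widehat{\mathbf b}^{\{m\}\top}-\mathcal P\widehat{\mathbf A}^{\{\ell,m\}}\mathcal P$, where $\mathbf 1$ is the vector of ones and $\mathcal P$ the order-reversing permutation matrix, each of the appropriate size. The time-reversed scheme of a GARK tableau is $\underline{\mathbf b}_{\mathrm{GARK}}=\mathcal P\mathbf b_{\mathrm{GARK}}$, $\underline{\mathbf A}_{\mathrm{GARK}}=\mathbf 1\mathbf b_{\mathrm{GARK}}^\top-\mathcal P\mathbf A_{\mathrm{GARK}}\mathcal P$, with $\mathcal P$ the block-diagonal matrix of the order-reversing permutations of the partitions; for the partitioned scheme its diagonal blocks are again replaced by $\mathbf 0$. Symmetric. A scheme is symmetric if it coincides with its time-reversed scheme; in particular the scheme $(\mathbf A^{\{\ell,m\}},\mathbf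 b^{\{m\}})$ is symmetric if $\mathbf b^{\{m\}}=\underline{\mathbf b}^{\{m\}}$, $\mathbf A^{\{\ell,m\}}=\underline{\mathbf A}^{\{\ell,m\}}$ for all $\ell,m$, and likewise for $(\widehat{\mathbf A}^{\{\ell,m\}},\widehat{\mathbf b}^{\{m\}})$. *)

theory Defs
  imports "Jordan_Normal_Form.Matrix"
begin

text \<open>
  Partitions and stages are numbered from 0. \<open>A q m\<close> is the coefficient block whose rows are
  indexed by the stages of partition \<open>q\<close> and whose columns are indexed by the stages of
  partition \<open>m\<close>; \<open>b m\<close> is the vector of weights of partition \<open>m\<close>.
\<close>

definition reversal_mat :: "nat \<Rightarrow> real mat" where
  "reversal_mat n = mat n n (\<lambda>(i, j). if i + j + 1 = n then 1 else 0)"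

definition ones_times_transpose :: "nat \<Rightarrow> real vec \<Rightarrow> real mat" where
  "ones_times_transpose n b = (mat_of_row (vec n (\<lambda>_. 1)))\<^sup>T * mat_of_row b"

text \<open>The underlined quantities; the permutations \<open>P\<close> on the left and on the right of a block may differ
  in size.\<close>

definition reversed_weights :: "real vec \<Rightarrow> real vec" where
  "reversed_weights b = reversal_mat (dim_vec b) *\<^sub>v b"

definition reversed_block :: "real mat \<Rightarrow> real vec \<Rightarrow> real mat" where
  "reversed_block A b =
     ones_times_transpose (dim_row A) b
       - reversal_mat (dim_row A) * A * reversal_mat (dim_col A)"

text \<open>
  The rows and the columns of the blocks may belong to different sets of stages, so this covers
  both \<open>(A, b)\<close> and \<open>(A', b')\<close> below.
\<close>

definition symmetric_scheme :: "nat \<Rightarrow> (nat \<Rightarrow> nat \<Rightarrow> real mat) \<Rightarrow> (nat \<Rightarrow> real vec) \<Rightarrow> bool" where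
  "symmetric_scheme N A b \<longleftrightarrow>
     (\<forall>m<N. b m = reversed_weights (b m)) \<and>
     (\<forall>l<N. \<forall>m<N. A l m = reversed_block (A l m) (b m))"

text \<open>
  In \<open>assemble_mat\<close>, block \<open>(q, m)\<close> has size \<open>r q \<times> c m\<close>.
\<close>

definition assemble_vec :: "nat \<Rightarrow> (nat \<Rightarrow> real vec) \<Rightarrow> real vec" where
  "assemble_vec N b = vec_of_list (concat (map (\<lambda>m. list_of_vec (b m)) [0..<N]))"

definition assemble_mat ::
  "nat \<Rightarrow> (nat \<Rightarrow> nat) \<Rightarrow> (nat \<Rightarrow> nat) \<Rightarrow> (nat \<Rightarrow> nat \<Rightarrow> real mat) \<Rightarrow> real mat" where
  "assemble_mat N r c A =
     mat_of_rows (\<Sum>m<N. c m)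
       (concat (map (\<lambda>q. map (\<lambda>i. assemble_vec N (\<lambda>m. row (A q m) i)) [0..<r q]) [0..<N]))"

datatype gark_scheme =
  GARK (stages: "nat list") (coeffs: "real mat") (weights: "real vec")

definition gark_reversal_mat :: "gark_scheme \<Rightarrow> real mat" where
  "gark_reversal_mat S = diag_block_mat (map reversal_mat (stages S))"

definition time_reversed :: "gark_scheme \<Rightarrow> gark_scheme" where
  "time_reversed S = GARK (stages S)
     (ones_times_transpose (dim_row (coeffs S)) (weights S)
        - gark_reversal_mat S * coeffs S * gark_reversal_mat S)
     (gark_reversal_mat S *\<^sub>v weights S)"

text \<open>
  The partitioned scheme has \<open>2 N\<close> partitions: partition \<open>m < N\<close> has \<open>s m\<close> stages, partition
  \<open>N + m\<close> has \<open>s' m\<close> stages; primes stand for hats.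
\<close>

definition partitioned_gark ::
  "nat \<Rightarrow> (nat \<Rightarrow> nat) \<Rightarrow> (nat \<Rightarrow> nat) \<Rightarrow>
   (nat \<Rightarrow> nat \<Rightarrow> real mat) \<Rightarrow> (nat \<Rightarrow> real vec) \<Rightarrow>
   (nat \<Rightarrow> nat \<Rightarrow> real mat) \<Rightarrow> (nat \<Rightarrow> real vec) \<Rightarrow> gark_scheme" where
  "partitioned_gark N s s' A b A' b' =
     (let n = (\<Sum>m<N. s m); n' = (\<Sum>m<N. s' m) in
      GARK (map s [0..<N] @ map s' [0..<N])
        (four_block_mat (0\<^sub>m n n) (assemble_mat N s s' A')
                        (assemble_mat N s' s A) (0\<^sub>m n' n'))
        (assemble_vec N b @\<^sub>v assemble_vec N b'))"

text \<open>
  The diagonal blocks have no effect on the computation of a partitioned scheme; its two diagonal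
  blocks are those of the \<open>2 \<times> 2\<close> structure whose leading block has size \<open>n\<close>.
\<close>

definition zero_diag_blocks :: "nat \<Rightarrow> real mat \<Rightarrow> real mat" where
  "zero_diag_blocks n M =
     mat (dim_row M) (dim_col M) (\<lambda>(i, j). if i < n \<longleftrightarrow> j < n then 0 else M $$ (i, j))"

definition partitioned_time_reversed :: "nat \<Rightarrow> gark_scheme \<Rightarrow> gark_scheme" where
  "partitioned_time_reversed n S =
     (let R = time_reversed S in
      GARK (stages R) (zero_diag_blocks n (coeffs R)) (weights R))"

definition symmetric_partitioned_gark ::
  "nat \<Rightarrow> (nat \<Rightarrow> nat) \<Rightarrow> (nat \<Rightarrow> nat) \<Rightarrow>
   (nat \<Rightarrow> nat \<Rightarrow> real mat) \<Rightarrow> (nat \<Rightarrow> real vec) \<Rightarrow>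
   (nat \<Rightarrow> nat \<Rightarrow> real mat) \<Rightarrow> (nat \<Rightarrow> real vec) \<Rightarrow> bool" where
  "symmetric_partitioned_gark N s s' A b A' b' \<longleftrightarrow>
     partitioned_gark N s s' A b A' b' =
       partitioned_time_reversed (\<Sum>m<N. s m) (partitioned_gark N s s' A b A' b')"

end

theory Submission
  imports Defs
begin

text \<open>
  The reversal matrix of a scheme is a permutation matrix, so conjugating by it only permutes the
  entries of the tableau. As that permutation preserves each partition, the equality of the
  partitioned scheme with its time-reversed scheme splits into one equality per block.
\<close>

section \<open>Order reversal inside consecutive segments, as a map on indices\<close>

fun block_rev :: "nat list \<Rightarrow> nat \<Rightarrow> nat" where
  "block_rev [] i = i"
| "block_rev (n # ns) i = (if i < n then n - 1 - i else n + block_rev ns (i - n))"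

lemma block_rev_less: "i < sum_list ns \<Longrightarrow> block_rev ns i < sum_list ns"
  by (induction ns i rule: block_rev.induct) auto

text \<open>No bound on \<open>i\<close> is required because the clause
  \<open>block_rev [] i = i\<close> leaves every index past the last segment fixed. The unbounded
  form is what \<open>perm_mat_conj_index\<close> asks of its column map.\<close>

lemma block_rev_block_rev: "block_rev ns (block_rev ns i) = i"
  by (induction ns i rule: block_rev.induct) auto

lemma block_rev_append:
  "block_rev (ns @ ms) i =
     (if i < sum_list ns then block_rev ns i else sum_list ns + block_rev ms (i - sum_list ns))"
  by (induction ns arbitrary: i) (auto simp: diff_diff_left)

section \<open>Permutation matrices and conjugation by them\<close>

definition perm_mat :: "nat \<Rightarrow> (nat \<Rightarrow> nat) \<Rightarrow> real mat" where
  "perm_mat n f = mat n n (\<lambda>(i, j). if j = f i then 1 else 0)"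

lemma perm_mat_carrier [simp]: "perm_mat n f \<in> carrier_mat n n"
  by (simp add: perm_mat_def)

lemma perm_mat_mult_vec_index:
  assumes "v \<in> carrier_vec n" "i < n" "f i < n"
  shows "(perm_mat n f *\<^sub>v v) $ i = v $ f i"
proof -
  have "(perm_mat n f *\<^sub>v v) $ i = (\<Sum>j<n. (if j = f i then 1 else 0) * v $ j)"
    using assms by (simp add: perm_mat_def scalar_prod_def atLeast0LessThan)
  also have "\<dots> = (\<Sum>j<n. if j = f i then v $ j else 0)"
    by (intro sum.cong) auto
  finally show ?thesis using assms by simp
qed

text \<open>The left factor reads row \<open>f i\<close>, while the right factor reads the columns
  that \<open>g\<close> sends to \<open>j\<close>; for an involution the only such column is
  \<open>g j\<close>. Two sizes and two maps occur because a block pairs the stages of two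
  partitions, whose numbers may differ.\<close>

lemma perm_mat_conj_index:
  assumes M: "M \<in> carrier_mat n k" and ij: "i < n" "j < k"
    and f: "f i < n" and g: "\<And>j. j < k \<Longrightarrow> g j < k" "\<And>j. g (g j) = j"
  shows "(perm_mat n f * M * perm_mat k g) $$ (i, j) = M $$ (f i, g j)"
proof -
  have L: "(perm_mat n f * M) $$ (i, l) = M $$ (f i, l)" if "l < k" for l
  proof -
    have "(perm_mat n f * M) $$ (i, l) = (perm_mat n f *\<^sub>v col M l) $ i"
      using M ij that by (simp add: perm_mat_def)
    also have "\<dots> = col M l $ f i"
      by (rule perm_mat_mult_vec_index) (use M ij f in auto)
    finally show ?thesis using M that f by simp
  qed
  have "(perm_mat n f * M * perm_mat k g) $$ (i, j) =
      (\<Sum>l<k. (perm_mat n f * M) $$ (i, l) * perm_mat k g $$ (l, j))"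
    using M ij by (simp add: perm_mat_def scalar_prod_def atLeast0LessThan)
  \<comment> \<open>The right factor contributes the condition \<open>j = g l\<close>, which the
    involution turns into \<open>l = g j\<close>. Keeping \<open>index_mult_mat\<close> out of the
    simplifier leaves the left product in the form rewritten by \<open>L\<close>.\<close>
  also have "\<dots> = (\<Sum>l<k. if l = g j then M $$ (f i, l) else 0)"
    using ij g(2) L by (intro sum.cong) (auto simp: perm_mat_def simp del: index_mult_mat)
  finally show ?thesis using ij g(1) by simp
qed

lemma reversal_mat_eq_perm_mat: "reversal_mat n = perm_mat n (\<lambda>i. n - 1 - i)"
  unfolding reversal_mat_def perm_mat_def by (rule eq_matI) auto

text \<open>Both sides follow the same recursion on the list: a leading block of size
  \<open>n\<close>, then the remaining blocks shifted by \<open>n\<close>.\<close>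

lemma diag_block_reversal_eq_perm_mat:
  "diag_block_mat (map reversal_mat ns) = perm_mat (sum_list ns) (block_rev ns)"
proof (induction ns)
  case Nil
  then show ?case by (auto simp: perm_mat_def)
next
  case (Cons n ns)
  then show ?case
    by (intro eq_matI) (auto simp: Let_def reversal_mat_eq_perm_mat perm_mat_def)
qed

lemma mult_carrier_perm_mat:
  assumes "M \<in> carrier_mat n k"
  shows "perm_mat n f * M * perm_mat k g \<in> carrier_mat n k"
  using assms by (intro mult_carrier_mat[of _ n k] mult_carrier_mat[of _ n n] perm_mat_carrier)

section \<open>Symmetry of one weight vector and of one block, entry by entry\<close>

lemma ones_times_transpose_carrier [simp]:
  "ones_times_transpose n b \<in> carrier_mat n (dim_vec b)"
  by (auto simp: ones_times_transpose_def)

lemma ones_times_transpose_index: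
  "i < n \<Longrightarrow> j < dim_vec b \<Longrightarrow> ones_times_transpose n b $$ (i, j) = b $ j"
  by (simp add: ones_times_transpose_def scalar_prod_def)

lemma eq_reversed_weights_iff:
  assumes "b \<in> carrier_vec n"
  shows "b = reversed_weights b \<longleftrightarrow> (\<forall>i<n. b $ i = b $ (n - 1 - i))"
proof -
  have "reversed_weights b \<in> carrier_vec n"
    using assms by (intro carrier_vecI) (simp add: reversed_weights_def reversal_mat_def)
  moreover have "reversed_weights b $ i = b $ (n - 1 - i)" if "i < n" for i
    unfolding reversed_weights_def reversal_mat_eq_perm_mat carrier_vecD[OF assms]
    by (rule perm_mat_mult_vec_index) (use assms that in auto)
  ultimately show ?thesis using assms by (auto simp: vec_eq_iff)
qed

lemma eq_reversed_block_iff: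
  assumes A: "A \<in> carrier_mat n k" and b: "b \<in> carrier_vec k"
  shows "A = reversed_block A b \<longleftrightarrow>
    (\<forall>i<n. \<forall>j<k. A $$ (i, j) = b $ j - A $$ (n - 1 - i, k - 1 - j))"
proof -
  let ?Q = "reversal_mat n * A * reversal_mat k"
  have Q: "?Q \<in> carrier_mat n k"
    unfolding reversal_mat_eq_perm_mat by (rule mult_carrier_perm_mat[OF A])
  have R: "reversed_block A b = ones_times_transpose n b - ?Q"
    using A by (simp add: reversed_block_def)
  have idx: "reversed_block A b $$ (i, j) = b $ j - A $$ (n - 1 - i, k - 1 - j)"
    if "i < n" "j < k" for i j
  proof -
    \<comment> \<open>With truncated subtraction, \<open>k - 1 - i\<close> is not an involution on
      all naturals: it sends every \<open>i \<ge> k\<close> to 0. The map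
      \<open>block_rev [k]\<close> agrees with it below \<open>k\<close> and is an involution
      everywhere.\<close>
    have *: "perm_mat k (\<lambda>i. k - 1 - i) = perm_mat k (block_rev [k])"
      by (auto simp: perm_mat_def)
    have "?Q $$ (i, j) = A $$ (n - 1 - i, block_rev [k] j)"
      unfolding reversal_mat_eq_perm_mat *
      by (rule perm_mat_conj_index[OF A])
        (use that block_rev_less[of _ "[k]"] block_rev_block_rev in auto)
    then have "?Q $$ (i, j) = A $$ (n - 1 - i, k - 1 - j)"
      using that by simp
    then show ?thesis
      unfolding R using that Q b by (simp add: ones_times_transpose_index del: index_mult_mat)
  qed
  have "reversed_block A b \<in> carrier_mat n k"
    unfolding R by (rule minus_carrier_mat[OF Q])
  then show ?thesis
    using A idx by (auto simp: mat_eq_iff)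
qed

section \<open>Global indices as an offset plus a stage number\<close>

lemma all_less_add_iff:
  "(\<forall>I<n + k. P I) \<longleftrightarrow> (\<forall>I<n. P I) \<and> (\<forall>i<k. P (n + i))" for n k :: nat
proof -
  have "P I" if "\<forall>I<n. P I" "\<forall>i<k. P (n + i)" "I < n + k" for I
  proof (cases "I < n")
    case False
    then have "P (n + (I - n))" using that by (intro that(2)[rule_format]) linarith
    then show ?thesis using False by simp
  qed (use that in blast)
  then show ?thesis by auto
qed

text \<open>Consecutive ranges of lengths \<open>s m\<close> tile the indices below the total, so a
  global index amounts to a partition and a stage in it. The induction splits off the last
  range.\<close>

lemma all_less_sum_iff:
  fixes s :: "nat \<Rightarrow> nat"
  shows "(\<forall>I<(\<Sum>m<N. s m). P I) \<longleftrightarrow> (\<forall>m<N. \<forall>i<s m. P ((\<Sum>k<m. s k) + i))"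
proof (induction N)
  case (Suc N)
  then show ?case by (auto simp: less_Suc_eq all_less_add_iff)
qed simp

lemma sum_less_sum_lessThan:
  fixes s :: "nat \<Rightarrow> nat"
  assumes "m < N" "i < s m"
  shows "(\<Sum>k<m. s k) + i < (\<Sum>k<N. s k)"
proof -
  have "(\<Sum>k<m. s k) + i < (\<Sum>k<Suc m. s k)" using assms by simp
  also have "\<dots> \<le> (\<Sum>k<N. s k)" using assms by (intro sum_mono2) auto
  finally show ?thesis .
qed

lemma sum_list_map_upt: "sum_list (map s [0..<N]) = (\<Sum>m<N. s m)" for s :: "nat \<Rightarrow> nat"
  by (simp add: interv_sum_list_conv_sum_set_nat atLeast0LessThan)

lemma upt_split_at: "m < N \<Longrightarrow> [0..<N] = [0..<m] @ m # [Suc m..<N]"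
  using upt_add_eq_append[of 0 m "N - m"] by (simp add: upt_conv_Cons)

text \<open>Cutting the list of sizes at \<open>m\<close> shows why: the earlier segments only add
  their total length as an offset, and the later ones are never reached.\<close>

lemma block_rev_map_upt:
  assumes "m < N" "i < s m"
  shows "block_rev (map s [0..<N]) ((\<Sum>k<m. s k) + i) = (\<Sum>k<m. s k) + (s m - 1 - i)"
  unfolding upt_split_at[OF assms(1)]
  using assms(2) by (simp add: block_rev_append sum_list_map_upt)

lemma length_concat_map_upt:
  assumes "\<And>m. m < N \<Longrightarrow> length (f m) = s m"
  shows "length (concat (map f [0..<N])) = (\<Sum>m<N. s m)"
  using assms by (induction N) auto

lemma nth_concat_map_upt:
  assumes "\<And>m. m < N \<Longrightarrow> length (f m) = s m" "m < N" "i < s m"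
  shows "concat (map f [0..<N]) ! ((\<Sum>k<m. s k) + i) = f m ! i"
proof -
  have "length (concat (map f [0..<m])) = (\<Sum>k<m. s k)"
    by (rule length_concat_map_upt) (use assms in auto)
  then show ?thesis using assms unfolding upt_split_at[OF assms(2)] by (simp add: nth_append)
qed

section \<open>Entries of assembled vectors and matrices\<close>

lemma assemble_vec_carrier:
  assumes "\<And>m. m < N \<Longrightarrow> b m \<in> carrier_vec (s m)"
  shows "assemble_vec N b \<in> carrier_vec (\<Sum>m<N. s m)"
  using length_concat_map_upt[of N "\<lambda>m. list_of_vec (b m)" s] assms
  by (auto simp: assemble_vec_def intro!: carrier_vecI)

lemma assemble_vec_index:
  assumes "\<And>m. m < N \<Longrightarrow> b m \<in> carrier_vec (s m)" "m < N" "i < s m"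
  shows "assemble_vec N b $ ((\<Sum>k<m. s k) + i) = b m $ i"
  using nth_concat_map_upt[of N "\<lambda>m. list_of_vec (b m)" s m i] assms
  by (simp add: assemble_vec_def vec_of_list_index list_of_vec_index carrier_vecD)

lemma assemble_mat_carrier: "assemble_mat N r c A \<in> carrier_mat (\<Sum>m<N. r m) (\<Sum>m<N. c m)"
  using length_concat_map_upt[of N "\<lambda>q. map (\<lambda>i. assemble_vec N (\<lambda>m. row (A q m) i)) [0..<r q]" r]
  by (auto simp: assemble_mat_def intro!: carrier_matI)

text \<open>An assembled matrix is a list of rows, each itself an assembled vector. The entry is
  therefore found by two lookups at an offset, first of the row in the list and then of the column
  in that row.\<close>

lemma assemble_mat_index:
  assumes A: "\<And>q m. q < N \<Longrightarrow> m < N \<Longrightarrow> A q m \<in> carrier_mat (r q) (c m)"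
    and "q < N" "m < N" "i < r q" "j < c m"
  shows "assemble_mat N r c A $$ ((\<Sum>k<q. r k) + i, (\<Sum>k<m. c k) + j) = A q m $$ (i, j)"
proof -
  let ?f = "\<lambda>q. map (\<lambda>i. assemble_vec N (\<lambda>m. row (A q m) i)) [0..<r q]"
  have len: "length (concat (map ?f [0..<N])) = (\<Sum>m<N. r m)"
    by (rule length_concat_map_upt) simp
  have "assemble_mat N r c A $$ ((\<Sum>k<q. r k) + i, (\<Sum>k<m. c k) + j) =
      (concat (map ?f [0..<N]) ! ((\<Sum>k<q. r k) + i)) $ ((\<Sum>k<m. c k) + j)"
    unfolding assemble_mat_def mat_of_rows_def
    using sum_less_sum_lessThan[of q N i r] sum_less_sum_lessThan[of m N j c] assms(2-5) len
    by simp
  also have "concat (map ?f [0..<N]) ! ((\<Sum>k<q. r k) + i) = assemble_vec N (\<lambda>m. row (A q m) i)"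
    by (subst nth_concat_map_upt) (use assms in auto)
  also have "\<dots> $ ((\<Sum>k<m. c k) + j) = row (A q m) i $ j"
    by (rule assemble_vec_index) (use assms A in \<open>auto intro!: carrier_vecI\<close>)
  also have "\<dots> = A q m $$ (i, j)"
    using A[OF assms(2,3)] assms(4,5) by simp
  finally show ?thesis .
qed

section \<open>Symmetry of assembled data, block by block\<close>

lemma assemble_vec_symmetric_iff:
  assumes b: "\<And>m. m < N \<Longrightarrow> b m \<in> carrier_vec (s m)"
  shows "(\<forall>I<(\<Sum>m<N. s m). assemble_vec N b $ I = assemble_vec N b $ block_rev (map s [0..<N]) I)
    \<longleftrightarrow> (\<forall>m<N. b m = reversed_weights (b m))" (is "?L \<longleftrightarrow> _")
proof -
  let ?v = "assemble_vec N b" and ?f = "block_rev (map s [0..<N])"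
  have idx: "?v $ ((\<Sum>k<m. s k) + i) = b m $ i" if "m < N" "i < s m" for m i
    by (rule assemble_vec_index) (use b that in auto)
  have rev: "?v $ ?f ((\<Sum>k<m. s k) + i) = b m $ (s m - 1 - i)" if "m < N" "i < s m" for m i
    unfolding block_rev_map_upt[where s = s, OF that] by (rule idx) (use that in auto)
  have "?L \<longleftrightarrow> (\<forall>m<N. \<forall>i<s m. ?v $ ((\<Sum>k<m. s k) + i) = ?v $ ?f ((\<Sum>k<m. s k) + i))"
    by (rule all_less_sum_iff)
  also have "\<dots> \<longleftrightarrow> (\<forall>m<N. \<forall>i<s m. b m $ i = b m $ (s m - 1 - i))"
    by (intro all_cong) (simp only: idx rev)
  also have "\<dots> \<longleftrightarrow> (\<forall>m<N. b m = reversed_weights (b m))"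
    by (intro all_cong) (simp only: eq_reversed_weights_iff[OF b])
  finally show ?thesis .
qed

text \<open>Row and column reversal keep an index inside its partition, so the equation at a
  position in block \<open>(q, m)\<close> involves only \<open>A q m\<close> and \<open>b m\<close>.
  Collecting these equations over the block gives its symmetry.\<close>

lemma assemble_mat_symmetric_iff:
  assumes A: "\<And>q m. q < N \<Longrightarrow> m < N \<Longrightarrow> A q m \<in> carrier_mat (r q) (c m)"
    and b: "\<And>m. m < N \<Longrightarrow> b m \<in> carrier_vec (c m)"
  shows "(\<forall>I<(\<Sum>m<N. r m). \<forall>J<(\<Sum>m<N. c m). assemble_mat N r c A $$ (I, J) =
      assemble_vec N b $ J -
        assemble_mat N r c A $$ (block_rev (map r [0..<N]) I, block_rev (map c [0..<N]) J))
    \<longleftrightarrow> (\<forall>q<N. \<forall>m<N. A q m = reversed_block (A q m) (b m))" (is "?L \<longleftrightarrow> _")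
proof -
  let ?M = "assemble_mat N r c A" and ?v = "assemble_vec N b"
  let ?f = "block_rev (map r [0..<N])" and ?g = "block_rev (map c [0..<N])"
  have vec: "?v $ ((\<Sum>k<m. c k) + j) = b m $ j" if "m < N" "j < c m" for m j
    by (rule assemble_vec_index) (use b that in auto)
  have idx: "?M $$ ((\<Sum>k<q. r k) + i, (\<Sum>k<m. c k) + j) = A q m $$ (i, j)"
    if "q < N" "m < N" "i < r q" "j < c m" for q m i j
    by (rule assemble_mat_index) (use A that in auto)
  have rev: "?M $$ (?f ((\<Sum>k<q. r k) + i), ?g ((\<Sum>k<m. c k) + j)) =
      A q m $$ (r q - 1 - i, c m - 1 - j)"
    if "q < N" "m < N" "i < r q" "j < c m" for q m i j
    unfolding block_rev_map_upt[where s = r, OF that(1,3)] block_rev_map_upt[where s = c, OF that(2,4)]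
    by (rule idx) (use that in auto)
  have "?L \<longleftrightarrow> (\<forall>q<N. \<forall>i<r q. \<forall>m<N. \<forall>j<c m.
      ?M $$ ((\<Sum>k<q. r k) + i, (\<Sum>k<m. c k) + j) = ?v $ ((\<Sum>k<m. c k) + j) -
        ?M $$ (?f ((\<Sum>k<q. r k) + i), ?g ((\<Sum>k<m. c k) + j)))"
    unfolding all_less_sum_iff ..
  also have "\<dots> \<longleftrightarrow> (\<forall>q<N. \<forall>i<r q. \<forall>m<N. \<forall>j<c m.
      A q m $$ (i, j) = b m $ j - A q m $$ (r q - 1 - i, c m - 1 - j))"
    by (intro all_cong) (simp only: vec idx rev)
  \<comment> \<open>Splitting the row index and then the column index yields the quantifier order
    \<open>q\<close>, \<open>i\<close>, \<open>m\<close>, \<open>j\<close>; moving \<open>m\<close>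
    forward groups the entries by block.\<close>
  also have "\<dots> \<longleftrightarrow> (\<forall>q<N. \<forall>m<N. \<forall>i<r q. \<forall>j<c m.
      A q m $$ (i, j) = b m $ j - A q m $$ (r q - 1 - i, c m - 1 - j))"
    by blast
  also have "\<dots> \<longleftrightarrow> (\<forall>q<N. \<forall>m<N. A q m = reversed_block (A q m) (b m))"
    by (intro all_cong) (simp only: eq_reversed_block_iff[OF A b])
  finally show ?thesis .
qed

section \<open>Symmetry of the full tableau\<close>

text \<open>Reversal preserves the index ranges below and above \<open>n\<close>, so each
  off-diagonal block of the tableau is compared with itself. The columns of \<open>M\<close> lie in
  the first range and meet the weights \<open>v\<close>; those of \<open>M'\<close> lie in the
  second and meet \<open>v'\<close>. Hence the condition decouples into one for
  \<open>(A, b)\<close> and one for \<open>(A', b')\<close>.\<close>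

lemma symmetric_partitioned_gark_iff:
  assumes A: "\<And>l m. l < N \<Longrightarrow> m < N \<Longrightarrow> A l m \<in> carrier_mat (s' l) (s m)"
    and A': "\<And>l m. l < N \<Longrightarrow> m < N \<Longrightarrow> A' l m \<in> carrier_mat (s l) (s' m)"
    and b: "\<And>m. m < N \<Longrightarrow> b m \<in> carrier_vec (s m)"
    and b': "\<And>m. m < N \<Longrightarrow> b' m \<in> carrier_vec (s' m)"
  shows "symmetric_partitioned_gark N s s' A b A' b' \<longleftrightarrow>
    symmetric_scheme N A b \<and> symmetric_scheme N A' b'"
proof -
  define n where "n = (\<Sum>m<N. s m)"
  define n' where "n' = (\<Sum>m<N. s' m)"
  define \<rho> where "\<rho> = block_rev (map s [0..<N])"
  define \<rho>' where "\<rho>' = block_rev (map s' [0..<N])"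
  define \<sigma> where "\<sigma> = block_rev (map s [0..<N] @ map s' [0..<N])"
  define M where "M = assemble_mat N s' s A"
  define M' where "M' = assemble_mat N s s' A'"
  define v where "v = assemble_vec N b"
  define v' where "v' = assemble_vec N b'"
  define C where "C = four_block_mat (0\<^sub>m n n) M' M (0\<^sub>m n' n')"
  define w where "w = v @\<^sub>v v'"
  define D where "D = perm_mat (n + n') \<sigma>"
  have M: "M \<in> carrier_mat n' n" "M' \<in> carrier_mat n n'"
    by (simp_all add: M_def M'_def n_def n'_def assemble_mat_carrier)
  have v: "v \<in> carrier_vec n" "v' \<in> carrier_vec n'"
    by (simp_all add: v_def v'_def n_def n'_def assemble_vec_carrier b b')
  have C: "C \<in> carrier_mat (n + n') (n + n')"
    by (simp add: C_def)
  have w: "w \<in> carrier_vec (n + n')"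
    using v by (simp add: w_def)
  have w_index: "i < n \<Longrightarrow> w $ i = v $ i" "i < n' \<Longrightarrow> w $ (n + i) = v' $ i" for i
    using v by (simp_all add: w_def)
  have C_index:
    "i < n \<Longrightarrow> j < n' \<Longrightarrow> C $$ (i, n + j) = M' $$ (i, j)"
    "i' < n' \<Longrightarrow> j' < n \<Longrightarrow> C $$ (n + i', j') = M $$ (i', j')"
    "i < n \<Longrightarrow> j' < n \<Longrightarrow> C $$ (i, j') = 0"
    "i' < n' \<Longrightarrow> j < n' \<Longrightarrow> C $$ (n + i', n + j) = 0" for i i' j j'
    using M by (simp_all add: C_def)
  have \<rho>: "\<rho> i < n" if "i < n" for i
    using that block_rev_less[of i "map s [0..<N]"] by (simp add: \<rho>_def n_def sum_list_map_upt)
  have \<rho>': "\<rho>' i < n'" if "i < n'" for i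
    using that block_rev_less[of i "map s' [0..<N]"] by (simp add: \<rho>'_def n'_def sum_list_map_upt)
  have \<sigma>_eq: "\<sigma> i = (if i < n then \<rho> i else n + \<rho>' (i - n))" for i
    by (simp add: \<sigma>_def \<rho>_def \<rho>'_def n_def block_rev_append sum_list_map_upt)
  have \<sigma>: "\<sigma> i < n + n'" if "i < n + n'" for i
    using that \<rho> \<rho>' by (auto simp: \<sigma>_eq intro: trans_less_add1)
  have \<sigma>_invol: "\<sigma> (\<sigma> i) = i" for i
    by (simp add: \<sigma>_def block_rev_block_rev)
  have S: "partitioned_gark N s s' A b A' b' = GARK (map s [0..<N] @ map s' [0..<N]) C w"
    by (simp add: partitioned_gark_def Let_def C_def w_def n_def n'_def M_def M'_def v_def v'_def)
  have R: "gark_reversal_mat (GARK (map s [0..<N] @ map s' [0..<N]) C w) = D"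
    \<comment> \<open>Flipping \<open>map_append\<close> keeps \<open>reversal_mat\<close> mapped
      over the whole list of stage numbers, as \<open>diag_block_reversal_eq_perm_mat\<close>
      expects.\<close>
    by (simp add: gark_reversal_mat_def D_def \<sigma>_def n_def n'_def sum_list_map_upt
        diag_block_reversal_eq_perm_mat flip: map_append)
  have DCD: "D * C * D \<in> carrier_mat (n + n') (n + n')"
    unfolding D_def by (rule mult_carrier_perm_mat[OF C])
  have DCD_index: "(D * C * D) $$ (I, J) = C $$ (\<sigma> I, \<sigma> J)" if "I < n + n'" "J < n + n'" for I J
    unfolding D_def by (rule perm_mat_conj_index[OF C]) (use that \<sigma> \<sigma>_invol in auto)
  have Dw: "D *\<^sub>v w \<in> carrier_vec (n + n')"
    by (intro carrier_vecI) (simp add: D_def perm_mat_def)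
  have Dw_index: "(D *\<^sub>v w) $ I = w $ \<sigma> I" if "I < n + n'" for I
    unfolding D_def by (rule perm_mat_mult_vec_index[OF w]) (use that \<sigma> in auto)
  \<comment> \<open>Time reversal leaves the stage list unchanged, so equality of the schemes leaves
    only the coefficients and the weights to compare.\<close>
  have "symmetric_partitioned_gark N s s' A b A' b' \<longleftrightarrow>
      C = zero_diag_blocks n (ones_times_transpose (n + n') w - D * C * D) \<and> w = D *\<^sub>v w"
    unfolding symmetric_partitioned_gark_def S partitioned_time_reversed_def time_reversed_def
      Let_def R n_def[symmetric]
    using C by simp
  also have "w = D *\<^sub>v w \<longleftrightarrow> (\<forall>I<n + n'. w $ I = w $ \<sigma> I)"
    using w Dw_index carrier_vecD[OF Dw]
    by (auto simp: vec_eq_iff simp del: index_mult_mat_vec dim_mult_mat_vec)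
  also have "\<dots> \<longleftrightarrow> (\<forall>I<n. v $ I = v $ \<rho> I) \<and> (\<forall>I<n'. v' $ I = v' $ \<rho>' I)"
    using \<rho> \<rho>' by (simp add: all_less_add_iff \<sigma>_eq w_index)
  also have "C = zero_diag_blocks n (ones_times_transpose (n + n') w - D * C * D) \<longleftrightarrow>
      (\<forall>I<n + n'. \<forall>J<n + n'. C $$ (I, J) =
        (if I < n \<longleftrightarrow> J < n then 0 else w $ J - C $$ (\<sigma> I, \<sigma> J)))"
    using C DCD DCD_index w
    by (auto simp: zero_diag_blocks_def mat_eq_iff ones_times_transpose_index carrier_vecD
        simp del: index_mult_mat)
  \<comment> \<open>Splitting both indices at \<open>n\<close> gives four ranges. On the two
    diagonal ones the equation is \<open>0 = 0\<close>; the other two give the conditions on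
    \<open>M\<close> and \<open>M'\<close>.\<close>
  also have "\<dots> \<longleftrightarrow>
      (\<forall>I<n'. \<forall>J<n. M $$ (I, J) = v $ J - M $$ (\<rho>' I, \<rho> J)) \<and>
      (\<forall>I<n. \<forall>J<n'. M' $$ (I, J) = v' $ J - M' $$ (\<rho> I, \<rho>' J))"
    using \<rho> \<rho>' by (auto simp: all_less_add_iff \<sigma>_eq w_index C_index)
  finally show ?thesis
    unfolding M_def M'_def v_def v'_def n_def n'_def \<rho>_def \<rho>'_def
    by (simp add: symmetric_scheme_def assemble_vec_symmetric_iff[OF b]
        assemble_vec_symmetric_iff[OF b'] assemble_mat_symmetric_iff[OF A b]
        assemble_mat_symmetric_iff[OF A' b']) blast
qed

theorem theorem4p4:
  fixes N :: nat and s s' :: "nat \<Rightarrow> nat"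
    and A A' :: "nat \<Rightarrow> nat \<Rightarrow> real mat" and b b' :: "nat \<Rightarrow> real vec"
  assumes "\<And>l m. l < N \<Longrightarrow> m < N \<Longrightarrow> A l m \<in> carrier_mat (s' l) (s m)"
    and "\<And>l m. l < N \<Longrightarrow> m < N \<Longrightarrow> A' l m \<in> carrier_mat (s l) (s' m)"
    and "\<And>m. m < N \<Longrightarrow> b m \<in> carrier_vec (s m)"
    and "\<And>m. m < N \<Longrightarrow> b' m \<in> carrier_vec (s' m)"
  shows "((\<forall>l<N. \<forall>m<N. b m = reversed_weights (b m) \<and> b' m = reversed_weights (b' m) \<and>
              A l m = reversed_block (A l m) (b m) \<and> A' l m = reversed_block (A' l m) (b' m))
            \<longrightarrow> symmetric_partitioned_gark N s s' A b A' b')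
       \<and> (symmetric_partitioned_gark N s s' A b A' b' \<longleftrightarrow>
            symmetric_scheme N A b \<and> symmetric_scheme N A' b')"
proof -
  have "symmetric_partitioned_gark N s s' A b A' b' \<longleftrightarrow>
      symmetric_scheme N A b \<and> symmetric_scheme N A' b'"
    by (rule symmetric_partitioned_gark_iff) (fact assms)+
  \<comment> \<open>The first claim is the backward direction of the equivalence: the joint
    condition over pairs \<open>l\<close>, \<open>m\<close> contains the weight conditions, as the
    choice \<open>l = m\<close> shows.\<close>
  then show ?thesis by (auto simp: symmetric_scheme_def)
qed

end
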